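(* For any triangle-free graph $G$ with $\rho(G)\leq \frac{33-\sqrt{161}}{116}$, we have $\beta(G)\leq\frac1{50}$.
   Context: All graphs are finite and simple. For a graph $G$ with $n\geq 1$ vertices, the edge density is $\rho(G)=\frac{2|E(G)|}{n^2}$. A half in $G$ is a function $\mu: V(G)\to[0,1]$ such that $\sum_{v\in V(G)}\mu(v)=n/2$. Put $\beta(G,\mu)=\frac1{n^2}\sum_{\{u,v\}\in E(G)}\mu(u)\mu(v)$ (each edge is counted once) and $\beta(G)=\min\{\beta(G,\mu): \mu \text{ is a half in } G\}$. *)

theory Defs
  imports "HOL-Analysis.Analysis"
begin

definition simple_graph :: "'a set \<Rightarrow> 'a set set \<Rightarrow> bool" where
  "simple_graph V E \<longleftrightarrow> finite V \<and> (\<forall>e\<in>E. e \<subseteq> V \<and> card e = 2)"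

text \<open>Edges have two elements, so \<open>u\<close>, \<open>v\<close>, \<open>w\<close> below are automatically distinct.\<close>

definition triangle_free :: "'a set set \<Rightarrow> bool" where
  "triangle_free E \<longleftrightarrow> \<not> (\<exists>u v w. {u, v} \<in> E \<and> {v, w} \<in> E \<and> {u, w} \<in> E)"

definition edge_density :: "'a set \<Rightarrow> 'a set set \<Rightarrow> real" where
  "edge_density V E = 2 * real (card E) / (real (card V))\<^sup>2"

text \<open>Only the values of \<open>\<mu>\<close> on the vertex set matter, here and in the definitions below.\<close>

definition half :: "'a set \<Rightarrow> ('a \<Rightarrow> real) \<Rightarrow> bool" where
  "half V \<mu> \<longleftrightarrow> (\<forall>v\<in>V. 0 \<le> \<mu> v \<and> \<mu> v \<le> 1) \<and> (\<Sum>v\<in>V. \<mu> v) = real (card V) / 2"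

text \<open>For an edge \<open>e = {u, v}\<close> the inner product below is \<open>\<mu> u * \<mu> v\<close>.\<close>

definition half_density :: "'a set \<Rightarrow> 'a set set \<Rightarrow> ('a \<Rightarrow> real) \<Rightarrow> real" where
  "half_density V E \<mu> = (\<Sum>e\<in>E. \<Prod>v\<in>e. \<mu> v) / (real (card V))\<^sup>2"

text \<open>\<^const>\<open>Least\<close> denotes the minimum whenever it is attained; lemmas
  \<open>min_half_density_attained\<close> and \<open>min_half_density_le\<close> below show that this is the case
  for every finite simple graph.\<close>

definition min_half_density :: "'a set \<Rightarrow> 'a set set \<Rightarrow> real" where
  "min_half_density V E = (LEAST b. \<exists>\<mu>. half V \<mu> \<and> b = half_density V E \<mu>)"

lemma ex_minimal_half:
  assumes "simple_graph V E"
  obtains \<mu> where "half V \<mu>" "\<And>\<nu>. half V \<nu> \<Longrightarrow> half_density V E \<mu> \<le> half_density V E \<nu>"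
proof -
  define R where "R = (\<Pi>\<^sub>E v\<in>UNIV. if v \<in> V then {0..1::real} else {0})"
  have "compactin (product_topology (\<lambda>_. euclidean) UNIV) R"
    unfolding R_def by (subst compactin_PiE) auto
  then have R: "compact R"
    by (simp add: euclidean_product_topology compactin_euclidean_iff)
  define H where "H = R \<inter> {\<mu>. (\<Sum>v\<in>V. \<mu> v) = real (card V) / 2}"
  have "closed {\<mu> :: 'a \<Rightarrow> real. (\<Sum>v\<in>V. \<mu> v) = real (card V) / 2}"
    by (intro closed_Collect_eq continuous_intros continuous_on_product_coordinates)
  with R have H: "compact H"
    unfolding H_def by (rule compact_Int_closed)
  have "(\<lambda>v. if v \<in> V then 1/2 else 0) \<in> H"
    by (auto simp: H_def R_def)
  then have "H \<noteq> {}" by blast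
  moreover have "continuous_on H (half_density V E)"
    unfolding half_density_def divide_inverse
    by (intro continuous_intros continuous_on_subset[OF continuous_on_product_coordinates]) simp
  ultimately obtain \<mu> where \<mu>: "\<mu> \<in> H" "\<And>\<nu>. \<nu> \<in> H \<Longrightarrow> half_density V E \<mu> \<le> half_density V E \<nu>"
    using continuous_attains_inf[OF H] by blast
  show thesis
  proof
    show "half V \<mu>"
      using \<mu>(1) by (fastforce simp: half_def H_def R_def PiE_iff split: if_splits)
  next
    fix \<nu> assume \<nu>: "half V \<nu>"
    define \<nu>' where "\<nu>' = (\<lambda>v. if v \<in> V then \<nu> v else 0)"
    have "\<nu>' \<in> H"
      using \<nu> by (auto simp: half_def H_def R_def \<nu>'_def)
    then have "half_density V E \<mu> \<le> half_density V E \<nu>'"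
      by (rule \<mu>(2))
    also have "(\<Sum>e\<in>E. \<Prod>v\<in>e. \<nu>' v) = (\<Sum>e\<in>E. \<Prod>v\<in>e. \<nu> v)"
      using assms by (intro sum.cong prod.cong) (auto simp: simple_graph_def \<nu>'_def)
    then have "half_density V E \<nu>' = half_density V E \<nu>"
      by (simp add: half_density_def)
    finally show "half_density V E \<mu> \<le> half_density V E \<nu>" .
  qed
qed

lemma min_half_density_attained:
  assumes "simple_graph V E"
  shows "\<exists>\<mu>. half V \<mu> \<and> min_half_density V E = half_density V E \<mu>"
proof -
  obtain \<mu> where \<mu>: "half V \<mu>" "\<And>\<nu>. half V \<nu> \<Longrightarrow> half_density V E \<mu> \<le> half_density V E \<nu>"
    using ex_minimal_half[OF assms] by blast
  then have "min_half_density V E = half_density V E \<mu>"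
    unfolding min_half_density_def by (intro Least_equality) auto
  with \<mu>(1) show ?thesis by blast
qed

lemma min_half_density_le:
  assumes "simple_graph V E" "half V \<nu>"
  shows "min_half_density V E \<le> half_density V E \<nu>"
proof -
  obtain \<mu> where \<mu>: "half V \<mu>" "\<And>\<nu>. half V \<nu> \<Longrightarrow> half_density V E \<mu> \<le> half_density V E \<nu>"
    using ex_minimal_half[OF assms(1)] by blast
  then have "min_half_density V E = half_density V E \<mu>"
    unfolding min_half_density_def by (intro Least_equality) auto
  with \<mu>(2)[OF assms(2)] show ?thesis by simp
qed

end

theory Submission
  imports Defs
begin

text \<open>
  Write \<open>\<rho>\<close> for the edge density and pick an edge \<open>uv\<close> whose normalised degrees \<open>a\<close>, \<open>b\<close> satisfy
  \<open>a + b \<ge> 2 * \<rho>\<close>. The neighbourhoods \<open>A\<close> of \<open>u\<close> and \<open>B\<close> of \<open>v\<close> are disjoint and independent; let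
  \<open>p\<close> be the normalised number of edges between them. Consider the perturbations of the constant
  half \<open>1/2\<close> that are \<open>1/2\<close> on \<open>A\<close>, \<open>\<plusminus>1/2\<close> on \<open>B\<close>, and constant on the remaining vertices. Each of
  them may be negated, and with the better sign the linear term of the density does no harm. The
  perturbation with equal signs on \<open>A\<close> and \<open>B\<close> then succeeds if \<open>p\<close> is small, the one with opposite
  signs if \<open>p\<close> is large, and \<open>58 * \<rho>\<^sup>2 - 33 * \<rho> + 4 \<ge> 0\<close> ensures that one of the two cases occurs.
  If \<open>a + b > 1/2\<close>, the equal-sign perturbation is replaced by a half supported on \<open>A \<union> B\<close>.
\<close>

section \<open>The edge form\<close>

text \<open>The bilinear form of the adjacency matrix. Summing over ordered pairs counts each edge
  twice.\<close>

definition edge_form :: "'a set \<Rightarrow> 'a set set \<Rightarrow> ('a \<Rightarrow> real) \<Rightarrow> ('a \<Rightarrow> real) \<Rightarrow> real" where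
  "edge_form V E f g = (\<Sum>u\<in>V. \<Sum>v\<in>V. of_bool ({u, v} \<in> E) * f u * g v)"

lemma edge_form_diag:
  assumes "simple_graph V E"
  shows "edge_form V E f f = 2 * (\<Sum>e\<in>E. \<Prod>v\<in>e. f v)"
proof -
  have fin: "finite V" and sub: "\<And>e. e \<in> E \<Longrightarrow> e \<subseteq> V" and two: "\<And>e. e \<in> E \<Longrightarrow> card e = 2"
    using assms by (auto simp: simple_graph_def)
  have finE: "finite E"
    using finite_subset[of E "Pow V"] fin sub by auto
  define D where "D = {(u, v). {u, v} \<in> E}"
  have D: "D \<subseteq> V \<times> V"
    using sub by (auto simp: D_def)
  then have finD: "finite D"
    using fin finite_subset by blast
  have "edge_form V E f f = (\<Sum>(u, v)\<in>V \<times> V. of_bool ({u, v} \<in> E) * f u * f v)"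
    by (simp add: edge_form_def sum.cartesian_product)
  also have "\<dots> = (\<Sum>(u, v)\<in>D. f u * f v)"
    by (rule sum.mono_neutral_cong_right) (use fin D in \<open>auto simp: D_def\<close>)
  \<comment> \<open>Group the ordered pairs by edge; each edge has two orientations.\<close>
  also have "\<dots> = (\<Sum>e\<in>E. \<Sum>(u, v)\<in>{x \<in> D. (\<lambda>(u, v). {u, v}) x = e}. f u * f v)"
    by (rule sum.group[symmetric]) (use finD finE in \<open>auto simp: D_def\<close>)
  also have "\<dots> = (\<Sum>e\<in>E. 2 * (\<Prod>v\<in>e. f v))"
  proof (rule sum.cong[OF refl])
    fix e assume e: "e \<in> E"
    obtain x y where xy: "e = {x, y}" "x \<noteq> y"
      using two[OF e] by (auto simp: card_2_iff)
    have "{x, y} \<in> E" "{y, x} \<in> E"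
      using e xy by (simp_all add: insert_commute)
    then have "z \<in> {z \<in> D. (\<lambda>(u, v). {u, v}) z = e} \<longleftrightarrow> z \<in> {(x, y), (y, x)}" for z
      unfolding D_def xy(1) by (cases z) (simp, metis doubleton_eq_iff)
    then have "{z \<in> D. (\<lambda>(u, v). {u, v}) z = e} = {(x, y), (y, x)}"
      by (rule set_eqI)
    then show "(\<Sum>(u, v)\<in>{x \<in> D. (\<lambda>(u, v). {u, v}) x = e}. f u * f v) = 2 * (\<Prod>v\<in>e. f v)"
      using xy by simp
  qed
  finally show ?thesis
    by (simp add: sum_distrib_left)
qed

lemma edge_form_commute: "edge_form V E f g = edge_form V E g f"
  unfolding edge_form_def
  by (subst sum.swap) (simp add: insert_commute mult.assoc mult.commute[of "f _"])

lemma edge_form_add_left: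
  "edge_form V E (\<lambda>v. f v + g v) h = edge_form V E f h + edge_form V E g h"
  by (simp add: edge_form_def sum.distrib distrib_left distrib_right)

lemma edge_form_scale_left: "edge_form V E (\<lambda>v. c * f v) g = c * edge_form V E f g"
  by (simp add: edge_form_def sum_distrib_left mult.assoc mult.left_commute)

lemma edge_form_add_right:
  "edge_form V E h (\<lambda>v. f v + g v) = edge_form V E h f + edge_form V E h g"
  by (simp add: edge_form_def sum.distrib distrib_left)

lemma edge_form_scale_right: "edge_form V E f (\<lambda>v. c * g v) = c * edge_form V E f g"
  by (simp add: edge_form_def sum_distrib_left mult.left_commute)

lemma edge_form_nonneg:
  assumes "\<And>v. 0 \<le> f v" "\<And>v. 0 \<le> g v"
  shows "0 \<le> edge_form V E f g"
  unfolding edge_form_def by (intro sum_nonneg mult_nonneg_nonneg assms) auto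

lemma edge_form_independent:
  assumes "\<And>x y. x \<in> A \<Longrightarrow> y \<in> A \<Longrightarrow> {x, y} \<notin> E"
  shows "edge_form V E (indicator A) (indicator A) = 0"
  unfolding edge_form_def using assms
  by (intro sum.neutral ballI) (auto simp: indicator_def)

text \<open>Expand the bilinear form: independence of \<open>A\<close> and \<open>B\<close> kills
  the terms in \<open>X * X\<close> and \<open>Y * Y\<close>. The final division by 2 undoes the
  double count of edges.\<close>

lemma half_density_three_level:
  assumes graph: "simple_graph V E"
    and A: "\<And>x y. x \<in> A \<Longrightarrow> y \<in> A \<Longrightarrow> {x, y} \<notin> E"
    and B: "\<And>x y. x \<in> B \<Longrightarrow> y \<in> B \<Longrightarrow> {x, y} \<notin> E"
  shows "half_density V E (\<lambda>v. \<alpha> + X * indicator A v + Y * indicator B v) =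
    (\<alpha>\<^sup>2 * edge_density V E
      + 2 * \<alpha> * X * (edge_form V E (\<lambda>_. 1) (indicator A) / (real (card V))\<^sup>2)
      + 2 * \<alpha> * Y * (edge_form V E (\<lambda>_. 1) (indicator B) / (real (card V))\<^sup>2)
      + 2 * X * Y * (edge_form V E (indicator A) (indicator B) / (real (card V))\<^sup>2)) / 2"
proof -
  have one: "edge_form V E (\<lambda>_. 1) (\<lambda>_. 1) = 2 * real (card E)"
    using edge_form_diag[OF graph, of "\<lambda>_. 1"] by simp
  have AA: "edge_form V E (indicator A) (indicator A) = 0"
    by (rule edge_form_independent) (rule A)
  have BB: "edge_form V E (indicator B) (indicator B) = 0"
    by (rule edge_form_independent) (rule B)
  \<comment> \<open>The factor \<open>1\<close> turns the constant summand into a scaled function,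
    so that the scaling rules apply.\<close>
  let ?\<mu> = "\<lambda>v. \<alpha> * 1 + X * indicator A v + Y * indicator B v :: real"
  have "edge_form V E ?\<mu> ?\<mu> = \<alpha>\<^sup>2 * (2 * real (card E))
      + 2 * \<alpha> * X * edge_form V E (\<lambda>_. 1) (indicator A)
      + 2 * \<alpha> * Y * edge_form V E (\<lambda>_. 1) (indicator B)
      + 2 * X * Y * edge_form V E (indicator A) (indicator B)"
    unfolding edge_form_add_left edge_form_add_right edge_form_scale_left edge_form_scale_right
    unfolding AA BB one
      edge_form_commute[of V E "indicator A" "\<lambda>_. 1"]
      edge_form_commute[of V E "indicator B" "\<lambda>_. 1"]
      edge_form_commute[of V E "indicator B" "indicator A"]
    by algebra
  moreover have "half_density V E ?\<mu> = edge_form V E ?\<mu> ?\<mu> / 2 / (real (card V))\<^sup>2"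
    by (simp add: half_density_def edge_form_diag[OF graph])
  ultimately have "half_density V E ?\<mu> = (\<alpha>\<^sup>2 * (2 * real (card E))
      + 2 * \<alpha> * X * edge_form V E (\<lambda>_. 1) (indicator A)
      + 2 * \<alpha> * Y * edge_form V E (\<lambda>_. 1) (indicator B)
      + 2 * X * Y * edge_form V E (indicator A) (indicator B)) / 2 / (real (card V))\<^sup>2"
    by (simp only:)
  then show ?thesis
    unfolding edge_density_def mult_1_right divide_inverse by algebra
qed

section \<open>An edge with large degree sum\<close>

definition neighbourhood :: "'a set set \<Rightarrow> 'a \<Rightarrow> 'a set" where
  "neighbourhood E v = {u. {v, u} \<in> E}"

lemma sum_neighbourhood:
  assumes "simple_graph V E" "v \<in> V"
  shows "(\<Sum>u\<in>V. of_bool ({v, u} \<in> E) * c) = real (card (neighbourhood E v)) * (c :: real)"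
proof -
  have "finite V" "neighbourhood E v \<subseteq> V"
    using assms by (auto simp: simple_graph_def neighbourhood_def)
  then have "V \<inter> {u. {v, u} \<in> E} = neighbourhood E v"
    by (auto simp: neighbourhood_def)
  then show ?thesis
    using \<open>finite V\<close> by (simp flip: sum_distrib_right)
qed

text \<open>The average of the degree sum over all edges is the sum of squared degrees divided by
  the number of edges. Cauchy-Schwarz bounds it below, since the degrees add up to twice that
  number.\<close>

lemma ex_edge_degree_sum_ge:
  assumes graph: "simple_graph V E" and "E \<noteq> {}"
  obtains u v where "{u, v} \<in> E"
    "real (card (neighbourhood E u)) + real (card (neighbourhood E v))
      \<ge> 4 * real (card E) / real (card V)"
proof (rule ccontr)
  assume "\<not> thesis"
  note witness = that
  define d where "d v = real (card (neighbourhood E v))" for v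
  define m where "m = 4 * real (card E) / real (card V)"
  have less: "d u + d v < m" if "{u, v} \<in> E" for u v
    using \<open>\<not> thesis\<close> witness[OF that] unfolding d_def m_def by argo
  have fin: "finite V"
    using graph by (simp add: simple_graph_def)
  obtain e where "e \<in> E" using \<open>E \<noteq> {}\<close> by blast
  then obtain x y where xy: "{x, y} \<in> E" "x \<in> V" "y \<in> V"
    using graph by (auto simp: simple_graph_def card_2_iff)
  then have n: "real (card V) > 0"
    using fin card_gt_0_iff by auto
  have total: "(\<Sum>u\<in>V. \<Sum>v\<in>V. of_bool ({u, v} \<in> E)) = 2 * real (card E)"
    using edge_form_diag[OF graph, of "\<lambda>_. 1"] by (simp add: edge_form_def)
  then have sum_d: "(\<Sum>v\<in>V. d v) = 2 * real (card E)"
    using sum_neighbourhood[OF graph, of _ 1] by (simp add: d_def)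
  have rows: "edge_form V E d (\<lambda>_. 1) = (\<Sum>v\<in>V. (d v)\<^sup>2)"
    using sum_neighbourhood[OF graph]
    by (simp add: edge_form_def d_def power2_eq_square)
  have "(\<Sum>u\<in>V. \<Sum>v\<in>V. of_bool ({u, v} \<in> E) * (d u + d v))
      < (\<Sum>u\<in>V. \<Sum>v\<in>V. of_bool ({u, v} \<in> E) * m)"
  proof (rule sum_strict_mono_ex1[OF fin])
    have le: "of_bool ({u, v} \<in> E) * (d u + d v) \<le> of_bool ({u, v} \<in> E) * m" for u v
      using less[of u v] by auto
    show "\<forall>u\<in>V. (\<Sum>v\<in>V. of_bool ({u, v} \<in> E) * (d u + d v)) \<le> (\<Sum>v\<in>V. of_bool ({u, v} \<in> E) * m)"
      by (intro ballI sum_mono le)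
    \<comment> \<open>The edge \<open>{x, y}\<close> makes the inequality strict in the row of
      \<open>x\<close>.\<close>
    have "(\<Sum>v\<in>V. of_bool ({x, v} \<in> E) * (d x + d v)) < (\<Sum>v\<in>V. of_bool ({x, v} \<in> E) * m)"
      by (rule sum_strict_mono_ex1[OF fin]) (use le less[OF xy(1)] xy in auto)
    then show "\<exists>u\<in>V. (\<Sum>v\<in>V. of_bool ({u, v} \<in> E) * (d u + d v)) < (\<Sum>v\<in>V. of_bool ({u, v} \<in> E) * m)"
      using xy by blast
  qed
  also have "(\<Sum>u\<in>V. \<Sum>v\<in>V. of_bool ({u, v} \<in> E) * (d u + d v))
      = edge_form V E d (\<lambda>_. 1) + edge_form V E (\<lambda>_. 1) d"
    by (simp add: edge_form_def sum.distrib distrib_left)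
  also have "\<dots> = 2 * (\<Sum>v\<in>V. (d v)\<^sup>2)"
    by (simp add: rows edge_form_commute[of V E "\<lambda>_. 1" d])
  also have "(\<Sum>u\<in>V. \<Sum>v\<in>V. of_bool ({u, v} \<in> E) * m) = 2 * real (card E) * m"
    by (simp add: total flip: sum_distrib_right)
  finally have "2 * (\<Sum>v\<in>V. (d v)\<^sup>2) * real (card V) < 2 * (2 * real (card E))\<^sup>2"
    using n by (simp add: m_def field_simps power2_eq_square)
  moreover have "(2 * real (card E))\<^sup>2 \<le> (\<Sum>v\<in>V. (d v)\<^sup>2) * real (card V)"
    using Cauchy_Schwarz_ineq_sum[of d "\<lambda>_. 1" V] sum_d by simp
  ultimately show False by linarith
qed

section \<open>Halves with three levels\<close>

text \<open>
  In the following three lemmas, \<open>\<alpha>\<close>, \<open>\<alpha> + X\<close> and \<open>\<alpha> + Y\<close> are the values of a half outside \<open>A \<union> B\<close>, on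
  \<open>A\<close> and on \<open>B\<close>, where \<open>A\<close> and \<open>B\<close> have relative sizes \<open>a\<close> and \<open>b\<close>; \<open>s\<close> and \<open>t\<close> are the normalised
  sums of the degrees over \<open>A\<close> and \<open>B\<close>. The last quantity in the lemmas is twice the density.
\<close>

lemma equal_sign_levels:
  fixes a b p q r s t :: real
  assumes "0 \<le> a" "0 \<le> b" "a + b \<le> 1/2"
    and q: "r / 4 + (p - (a + b)\<^sup>2 * r / 2) / (2 * (1 - a - b)\<^sup>2) \<le> q"
  shows "\<exists>\<alpha> X Y. 0 \<le> \<alpha> \<and> \<alpha> \<le> 1 \<and> 0 \<le> \<alpha> + X \<and> \<alpha> + X \<le> 1 \<and> 0 \<le> \<alpha> + Y \<and> \<alpha> + Y \<le> 1 \<and>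
    \<alpha> + X * a + Y * b = 1/2 \<and>
    \<alpha>\<^sup>2 * r + 2 * \<alpha> * X * s + 2 * \<alpha> * Y * t + 2 * X * Y * p \<le> q"
proof -
  define c where "c = a + b"
  define w where "w = 1 - a - b"
  have w: "w > 0" "c \<le> w" "0 \<le> c" "c = 1 - w" "w \<le> 1"
    using assms by (auto simp: c_def w_def)
  \<comment> \<open>The mean forces \<open>\<alpha> = 1/2 - c * X\<close> when \<open>X = Y\<close>;
    then \<open>h\<close> is the coefficient of \<open>X\<close> in twice the density, and
    \<open>\<epsilon>\<close> makes \<open>X * h\<close> nonpositive.\<close>
  define h where "h = s + t - c * r"
  define \<epsilon> :: real where "\<epsilon> = (if h \<ge> 0 then - 1 else 1)"
  have \<epsilon>: "\<epsilon> * \<epsilon> = 1" "\<epsilon> * h = - \<bar>h\<bar>" "\<bar>\<epsilon>\<bar> = 1"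
    by (auto simp: \<epsilon>_def)
  \<comment> \<open>This step length takes \<open>\<alpha> + X\<close> to 0 or 1, while
    \<open>c \<le> w\<close> keeps \<open>\<alpha>\<close> in range.\<close>
  define X where "X = \<epsilon> / (2 * w)"
  define \<alpha> where "\<alpha> = 1/2 - c * X"
  have "\<bar>c * X\<bar> \<le> 1/2"
    using w \<epsilon> by (simp add: X_def abs_mult field_simps)
  moreover have "\<alpha> + X = 1/2 + \<epsilon> / 2"
    using w by (simp add: \<alpha>_def X_def w(4) field_simps)
  ultimately have range: "0 \<le> \<alpha>" "\<alpha> \<le> 1" "0 \<le> \<alpha> + X" "\<alpha> + X \<le> 1"
    using \<epsilon>(3) by (auto simp: \<alpha>_def)
  have mean: "\<alpha> + X * a + X * b = 1/2"
    by (simp add: \<alpha>_def c_def algebra_simps)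
  have "X * X = 1 / (4 * w\<^sup>2)"
    using \<epsilon> w by (simp add: X_def power2_eq_square field_simps)
  moreover have "\<alpha>\<^sup>2 * r + 2 * \<alpha> * X * s + 2 * \<alpha> * X * t + 2 * X * X * p
      = r / 4 + X * h + (X * X) * (2 * p - c\<^sup>2 * r - 2 * c * h)"
    by (simp add: \<alpha>_def h_def algebra_simps power2_eq_square)
  moreover have "X * h + 1 / (4 * w\<^sup>2) * (2 * p - c\<^sup>2 * r - 2 * c * h)
      = (p - c\<^sup>2 * r / 2) / (2 * w\<^sup>2) + (w * (\<epsilon> * h) - c * h) / (2 * w\<^sup>2)"
    using w by (simp add: X_def field_simps power2_eq_square)
  ultimately have "\<alpha>\<^sup>2 * r + 2 * \<alpha> * X * s + 2 * \<alpha> * X * t + 2 * X * X * p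
      = r / 4 + (p - c\<^sup>2 * r / 2) / (2 * w\<^sup>2) + (w * (\<epsilon> * h) - c * h) / (2 * w\<^sup>2)"
    by simp
  \<comment> \<open>The quadratic part also contains \<open>h\<close>, with weight \<open>c\<close>;
    the linear gain has weight \<open>w\<close> and absorbs it.\<close>
  moreover have "w * (\<epsilon> * h) - c * h \<le> 0"
  proof -
    have "- (c * h) \<le> c * \<bar>h\<bar>" using w by (simp add: abs_if mult_nonneg_nonpos)
    also have "\<dots> \<le> w * \<bar>h\<bar>" using w by (intro mult_right_mono) auto
    finally show ?thesis by (simp add: \<epsilon>)
  qed
  then have "(w * (\<epsilon> * h) - c * h) / (2 * w\<^sup>2) \<le> 0"
    by (simp add: divide_nonpos_nonneg)
  ultimately have "\<alpha>\<^sup>2 * r + 2 * \<alpha> * X * s + 2 * \<alpha> * X * t + 2 * X * X * p \<le> q"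
    using q unfolding c_def w_def by linarith
  with range mean show ?thesis
    by blast
qed

lemma opposite_sign_levels:
  fixes a b p q r s t :: real
  assumes "0 \<le> a" "0 \<le> b" "a < 1/2" "b < 1/2"
    and q: "r / 4 - (((1 - a - b)\<^sup>2 - (a - b)\<^sup>2) * p + (a - b)\<^sup>2 * r / 2) / (2 * (1 - a - b)\<^sup>2) \<le> q"
  shows "\<exists>\<alpha> X Y. 0 \<le> \<alpha> \<and> \<alpha> \<le> 1 \<and> 0 \<le> \<alpha> + X \<and> \<alpha> + X \<le> 1 \<and> 0 \<le> \<alpha> + Y \<and> \<alpha> + Y \<le> 1 \<and>
    \<alpha> + X * a + Y * b = 1/2 \<and>
    \<alpha>\<^sup>2 * r + 2 * \<alpha> * X * s + 2 * \<alpha> * Y * t + 2 * X * Y * p \<le> q"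
proof -
  define d where "d = a - b"
  define w where "w = 1 - a - b"
  have w: "w > 0" "\<bar>d\<bar> \<le> w"
    using assms by (auto simp: d_def w_def)
  have ab: "a = (1 - w + d) / 2" "b = (1 - w - d) / 2"
    by (auto simp: d_def w_def)
  \<comment> \<open>The factors \<open>w + d\<close> and \<open>w - d\<close> are
    \<open>1 - 2 * b\<close> and \<open>1 - 2 * a\<close>. Scaling by \<open>k\<close> moves the
    levels on the two sets to 0 and 1 in opposite directions; \<open>h\<close> is the coefficient of
    \<open>k\<close>.\<close>
  define h where "h = s * (w + d) - t * (w - d) - d * r"
  define \<epsilon> :: real where "\<epsilon> = (if h \<ge> 0 then - 1 else 1)"
  have \<epsilon>: "\<epsilon> * \<epsilon> = 1" "\<epsilon> * h = - \<bar>h\<bar>" "\<bar>\<epsilon>\<bar> = 1"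
    by (auto simp: \<epsilon>_def)
  define k where "k = \<epsilon> / (2 * w)"
  define \<alpha> where "\<alpha> = 1/2 - d * k"
  define X where "X = k * (w + d)"
  define Y where "Y = - k * (w - d)"
  have "\<bar>d * k\<bar> \<le> 1/2"
    using w \<epsilon> by (simp add: k_def abs_mult field_simps)
  moreover have "\<alpha> + X = 1/2 + \<epsilon> / 2" "\<alpha> + Y = 1/2 - \<epsilon> / 2"
    using w by (simp_all add: \<alpha>_def X_def Y_def k_def field_simps)
  ultimately have range: "0 \<le> \<alpha>" "\<alpha> \<le> 1" "0 \<le> \<alpha> + X" "\<alpha> + X \<le> 1" "0 \<le> \<alpha> + Y" "\<alpha> + Y \<le> 1"
    using \<epsilon>(3) by (auto simp: \<alpha>_def)
  have mean: "\<alpha> + X * a + Y * b = 1/2"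
    by (simp add: \<alpha>_def X_def Y_def ab field_simps)
  have "k * k = 1 / (4 * w\<^sup>2)"
    using \<epsilon> w by (simp add: k_def power2_eq_square field_simps)
  moreover have "\<alpha>\<^sup>2 * r + 2 * \<alpha> * X * s + 2 * \<alpha> * Y * t + 2 * X * Y * p
      = r / 4 + k * h + (k * k) * (- 2 * (w\<^sup>2 - d\<^sup>2) * p - d\<^sup>2 * r - 2 * d * h)"
    by (simp add: \<alpha>_def X_def Y_def h_def algebra_simps power2_eq_square)
  moreover have "k * h + 1 / (4 * w\<^sup>2) * (- 2 * (w\<^sup>2 - d\<^sup>2) * p - d\<^sup>2 * r - 2 * d * h)
      = (w * (\<epsilon> * h) - d * h) / (2 * w\<^sup>2) - ((w\<^sup>2 - d\<^sup>2) * p + d\<^sup>2 * r / 2) / (2 * w\<^sup>2)"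
    using w by (simp add: k_def field_simps power2_eq_square)
  ultimately have "\<alpha>\<^sup>2 * r + 2 * \<alpha> * X * s + 2 * \<alpha> * Y * t + 2 * X * Y * p
      = r / 4 - ((w\<^sup>2 - d\<^sup>2) * p + d\<^sup>2 * r / 2) / (2 * w\<^sup>2) + (w * (\<epsilon> * h) - d * h) / (2 * w\<^sup>2)"
    by simp
  moreover have "w * (\<epsilon> * h) - d * h \<le> 0"
  proof -
    have "- (d * h) \<le> \<bar>d\<bar> * \<bar>h\<bar>" using abs_ge_minus_self[of "d * h"] by (simp add: abs_mult)
    also have "\<dots> \<le> w * \<bar>h\<bar>" using w by (intro mult_right_mono) auto
    finally show ?thesis by (simp add: \<epsilon>)
  qed
  then have "(w * (\<epsilon> * h) - d * h) / (2 * w\<^sup>2) \<le> 0"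
    by (simp add: divide_nonpos_nonneg)
  ultimately have "\<alpha>\<^sup>2 * r + 2 * \<alpha> * X * s + 2 * \<alpha> * Y * t + 2 * X * Y * p \<le> q"
    using q unfolding d_def w_def by linarith
  with range mean show ?thesis
    by blast
qed

lemma ex_good_levels:
  fixes a b p r s t :: real
  assumes ab: "0 \<le> a" "0 \<le> b" and p: "0 \<le> p"
    and r: "4/25 < r" "r \<le> (33 - sqrt 161) / 116" and heavy: "2 * r \<le> a + b"
  shows "\<exists>\<alpha> X Y. 0 \<le> \<alpha> \<and> \<alpha> \<le> 1 \<and> 0 \<le> \<alpha> + X \<and> \<alpha> + X \<le> 1 \<and> 0 \<le> \<alpha> + Y \<and> \<alpha> + Y \<le> 1 \<and>
    \<alpha> + X * a + Y * b = 1/2 \<and>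
    \<alpha>\<^sup>2 * r + 2 * \<alpha> * X * s + 2 * \<alpha> * Y * t + 2 * X * Y * p \<le> 1/25"
proof -
  \<comment> \<open>The constant half gives \<open>r / 4\<close>, so a saving of
    \<open>g / 2\<close> reaches \<open>1/25\<close>.\<close>
  define g where "g = r / 2 - 2/25"
  have "12 < sqrt 161"
    by (simp add: real_less_rsqrt)
  have g: "0 < g" "g < 1/50"
    using r \<open>12 < sqrt 161\<close> by (auto simp: g_def)
  \<comment> \<open>The bound on \<open>r\<close> is the smaller root of this quadratic, whose
    discriminant is 161.\<close>
  have quadratic: "0 \<le> 58 * r\<^sup>2 - 33 * r + 4"
  proof -
    have "(sqrt 161)\<^sup>2 \<le> (33 - 116 * r)\<^sup>2"
      using r by (intro power_mono) auto
    then show ?thesis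
      by (simp add: power2_eq_square algebra_simps)
  qed
  show ?thesis
  proof (cases "a < 1/2 \<and> b < 1/2")
    \<comment> \<open>A half spread evenly over one independent set has density 0.\<close>
    case False
    then consider "a \<ge> 1/2" | "b \<ge> 1/2" by linarith
    then show ?thesis
    proof cases
      case 1
      then show ?thesis
        by (intro exI[of _ 0] exI[of _ "1 / (2 * a)"] exI[of _ 0]) (auto simp: field_simps)
    next
      case 2
      then show ?thesis
        by (intro exI[of _ 0] exI[of _ 0] exI[of _ "1 / (2 * b)"]) (auto simp: field_simps)
    qed
  next
    case True
    define c where "c = a + b"
    define d where "d = a - b"
    define w where "w = 1 - a - b"
    have w: "w > 0" "\<bar>d\<bar> \<le> w" "w = 1 - c"
      using True ab by (auto simp: c_def d_def w_def)
    then have dw: "d\<^sup>2 \<le> w\<^sup>2"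
      by (metis abs_le_square_iff abs_of_pos)
    show ?thesis
    \<comment> \<open>The condition says that opposite signs save at least \<open>g / 2\<close>; its
      failure limits \<open>p\<close> from above.\<close>
    proof (cases "g * w\<^sup>2 \<le> (w\<^sup>2 - d\<^sup>2) * p + d\<^sup>2 * r / 2")
      case True
      then have "g / 2 \<le> ((w\<^sup>2 - d\<^sup>2) * p + d\<^sup>2 * r / 2) / (2 * w\<^sup>2)"
        using w(1) by (simp add: field_simps)
      then have "r / 4 - ((w\<^sup>2 - d\<^sup>2) * p + d\<^sup>2 * r / 2) / (2 * w\<^sup>2) \<le> r / 4 - g / 2"
        by (rule diff_left_mono)
      also have "r / 4 - g / 2 = 1/25"
        by (simp add: g_def field_simps)
      finally have "r / 4 - ((w\<^sup>2 - d\<^sup>2) * p + d\<^sup>2 * r / 2) / (2 * w\<^sup>2) \<le> 1/25" .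
      then show ?thesis
        using ab \<open>a < 1/2 \<and> b < 1/2\<close> unfolding d_def w_def
        by (intro opposite_sign_levels) auto
    next
      case small: False
      show ?thesis
      proof (cases "c \<le> 1/2")
        case True
        \<comment> \<open>The worst case is \<open>c = 2 * r\<close>, where the claim becomes
          \<open>quadratic\<close>.\<close>
        have "g * (1 + w\<^sup>2) \<le> g * (1 + (1 - 2 * r)\<^sup>2)"
          using g heavy w True by (intro mult_left_mono add_left_mono power_mono) (auto simp: c_def)
        also have "\<dots> = r * (2 * r)\<^sup>2 / 2 - (58 * r\<^sup>2 - 33 * r + 4) / 25"
          by (simp add: g_def field_simps power2_eq_square)
        also have "\<dots> \<le> r * (2 * r)\<^sup>2 / 2"
          using quadratic by simp
        also have "\<dots> \<le> r * c\<^sup>2 / 2"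
          using r heavy by (intro divide_right_mono mult_left_mono power_mono) (auto simp: c_def)
        finally have key: "g * (1 + w\<^sup>2) \<le> r * c\<^sup>2 / 2" .
        \<comment> \<open>This is the saving of \<open>g / 2\<close> with equal signs. For
          \<open>d = 0\<close> it follows from \<open>small\<close> and \<open>key\<close>; the
          terms in \<open>d\<close> only help.\<close>
        have "p \<le> c\<^sup>2 * r / 2 - g * w\<^sup>2"
        proof (rule ccontr)
          assume "\<not> ?thesis"
          then have "(w\<^sup>2 - d\<^sup>2) * (c\<^sup>2 * r / 2 - g * w\<^sup>2) \<le> (w\<^sup>2 - d\<^sup>2) * p"
            using dw by (intro mult_left_mono) auto
          then have "(w\<^sup>2 - d\<^sup>2) * (c\<^sup>2 * r / 2 - g * w\<^sup>2) < g * w\<^sup>2 - d\<^sup>2 * r / 2"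
            using small by linarith
          moreover have "w\<^sup>2 * (g * (1 + w\<^sup>2)) \<le> w\<^sup>2 * (r * c\<^sup>2 / 2)"
            using key by (intro mult_left_mono) auto
          moreover have "0 \<le> g * (w\<^sup>2 * d\<^sup>2)"
            using g by simp
          moreover have "c\<^sup>2 \<le> 1"
            using True ab by (simp add: c_def power_le_one)
          then have "0 \<le> (d\<^sup>2 * r / 2) * (1 - c\<^sup>2)"
            using r by (intro mult_nonneg_nonneg) auto
          moreover have "(w\<^sup>2 - d\<^sup>2) * (c\<^sup>2 * r / 2 - g * w\<^sup>2) - (g * w\<^sup>2 - d\<^sup>2 * r / 2)
              = (w\<^sup>2 * (r * c\<^sup>2 / 2) - w\<^sup>2 * (g * (1 + w\<^sup>2))) + g * (w\<^sup>2 * d\<^sup>2)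
                + (d\<^sup>2 * r / 2) * (1 - c\<^sup>2)"
            by (simp add: field_simps power2_eq_square)
          ultimately show False
            by linarith
        qed
        then have "(p - c\<^sup>2 * r / 2) / (2 * w\<^sup>2) \<le> - g / 2"
          using w(1) by (simp add: field_simps)
        then have "r / 4 + (p - c\<^sup>2 * r / 2) / (2 * w\<^sup>2) \<le> r / 4 + - g / 2"
          by (rule add_left_mono)
        also have "r / 4 + - g / 2 = 1/25"
          by (simp add: g_def field_simps)
        finally have "r / 4 + (p - c\<^sup>2 * r / 2) / (2 * w\<^sup>2) \<le> 1/25" .
        then show ?thesis
          using ab True unfolding c_def w_def
          by (intro equal_sign_levels) auto
      next
        case False
        \<comment> \<open>By \<open>small\<close>, the average of \<open>p\<close> and
          \<open>r / 2\<close> with weights \<open>w\<^sup>2 - d\<^sup>2\<close> and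
          \<open>d\<^sup>2\<close> is below \<open>g\<close>, whereas \<open>r / 2\<close> exceeds
          \<open>g\<close>.\<close>
        have "p \<le> g"
        proof (rule ccontr)
          assume "\<not> p \<le> g"
          then have "(w\<^sup>2 - d\<^sup>2) * g \<le> (w\<^sup>2 - d\<^sup>2) * p"
            using dw by (intro mult_left_mono) auto
          moreover have "d\<^sup>2 * g \<le> d\<^sup>2 * r / 2"
            using mult_left_mono[of g "r / 2" "d\<^sup>2"] by (simp add: g_def)
          ultimately show False
            using small by (simp add: algebra_simps)
        qed
        \<comment> \<open>The constant value on both sets of a half vanishing elsewhere;
          \<open>1/2 < c\<close> keeps it below 1.\<close>
        define k where "k = 1 / (2 * c)"
        have k: "0 \<le> k" "k \<le> 1" "k * c = 1/2"
          using False by (simp_all add: k_def)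
        have "k\<^sup>2 * p \<le> 1 * g"
          using p k \<open>p \<le> g\<close> by (intro mult_mono power_le_one) auto
        then have "2 * k * k * p \<le> 1/25"
          using g by (simp add: power2_eq_square)
        moreover have "k * a + k * b = 1/2"
          using k(3) by (simp add: c_def distrib_left)
        ultimately show ?thesis
          using k by (intro exI[of _ 0] exI[of _ k]) auto
      qed
    qed
  qed
qed

section \<open>The half obtained from a heavy edge\<close>

theorem theorem3p4:
  fixes V :: "'a set" and E :: "'a set set"
  assumes "simple_graph V E"
    and "V \<noteq> {}"
    and "triangle_free E"
    and "edge_density V E \<le> (33 - sqrt 161) / 116"
  shows "min_half_density V E \<le> 1 / 50"
proof -
  define n where "n = real (card V)"
  define r where "r = edge_density V E"
  have fin: "finite V" and sub: "\<And>e. e \<in> E \<Longrightarrow> e \<subseteq> V"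
    using assms(1) by (auto simp: simple_graph_def)
  have n: "n > 0"
    using fin \<open>V \<noteq> {}\<close> by (simp add: n_def card_gt_0_iff)
  have bound: "min_half_density V E \<le> 1/50"
    if "half V \<mu>" "half_density V E \<mu> \<le> 1/50" for \<mu>
    using min_half_density_le[OF assms(1) that(1)] that(2) by simp
  show ?thesis
  proof (cases "r \<le> 4/25")
    \<comment> \<open>The constant half has density \<open>r / 8\<close>.\<close>
    case True
    show ?thesis
    proof (rule bound)
      show "half V (\<lambda>_. 1/2)"
        by (simp add: half_def)
      show "half_density V E (\<lambda>_. 1/2) \<le> 1/50"
        using True half_density_three_level[OF assms(1), of "{}" "{}" "1/2" 0 0]
        by (simp add: r_def power2_eq_square)
    qed
  next
    case False
    then have "E \<noteq> {}"
      by (auto simp: r_def edge_density_def)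
    then obtain u v where uv: "{u, v} \<in> E"
      and deg: "real (card (neighbourhood E u)) + real (card (neighbourhood E v)) \<ge> 4 * real (card E) / n"
      using ex_edge_degree_sum_ge[OF assms(1)] unfolding n_def by metis
    define A where "A = neighbourhood E u"
    define B where "B = neighbourhood E v"
    have AV: "A \<subseteq> V" and BV: "B \<subseteq> V"
      using sub by (auto simp: A_def B_def neighbourhood_def)
    have A: "{x, y} \<notin> E" if "x \<in> A" "y \<in> A" for x y
      using that \<open>triangle_free E\<close> unfolding A_def neighbourhood_def triangle_free_def by blast
    have B: "{x, y} \<notin> E" if "x \<in> B" "y \<in> B" for x y
      using that \<open>triangle_free E\<close> unfolding B_def neighbourhood_def triangle_free_def by blast
    \<comment> \<open>Disjointness excludes the value \<open>\<alpha> + X + Y\<close>, which the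
      range bounds do not control.\<close>
    have disjoint: "x \<notin> B" if "x \<in> A" for x
      using that uv \<open>triangle_free E\<close>
      unfolding A_def B_def neighbourhood_def triangle_free_def by blast
    define a where "a = real (card A) / n"
    define b where "b = real (card B) / n"
    define p where "p = edge_form V E (indicator A) (indicator B) / n\<^sup>2"
    have "2 * r \<le> a + b"
      using deg n by (simp add: r_def a_def b_def A_def B_def edge_density_def
          flip: n_def add_divide_distrib) (simp add: field_simps power2_eq_square)
    moreover have "0 \<le> a" "0 \<le> b" "0 \<le> p"
      using n by (auto simp: a_def b_def p_def edge_form_nonneg)
    moreover have "4/25 < r" "r \<le> (33 - sqrt 161) / 116"
      using False assms(4) by (auto simp: r_def)
    ultimately obtain \<alpha> X Y where range: "0 \<le> \<alpha>" "\<alpha> \<le> 1" "0 \<le> \<alpha> + X" "\<alpha> + X \<le> 1"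
        "0 \<le> \<alpha> + Y" "\<alpha> + Y \<le> 1"
      and mean: "\<alpha> + X * a + Y * b = 1/2"
      and density: "\<alpha>\<^sup>2 * r + 2 * \<alpha> * X * (edge_form V E (\<lambda>_. 1) (indicator A) / n\<^sup>2)
        + 2 * \<alpha> * Y * (edge_form V E (\<lambda>_. 1) (indicator B) / n\<^sup>2) + 2 * X * Y * p \<le> 1/25"
      using ex_good_levels by blast
    let ?\<mu> = "\<lambda>v. \<alpha> + X * indicator A v + Y * indicator B v :: real"
    show ?thesis
    proof (rule bound)
      have "(\<Sum>v\<in>V. ?\<mu> v) = n * \<alpha> + X * card A + Y * card B"
        using fin AV BV
        by (simp add: sum.distrib n_def indicator_def Int_absorb1 flip: sum_distrib_left)
      also have "\<dots> = n * (\<alpha> + X * a + Y * b)"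
        using n by (simp add: a_def b_def field_simps)
      finally have "(\<Sum>v\<in>V. ?\<mu> v) = n / 2"
        by (simp add: mean)
      then show "half V ?\<mu>"
        using range disjoint by (auto simp: half_def n_def indicator_def)
      show "half_density V E ?\<mu> \<le> 1/50"
        using density half_density_three_level[OF assms(1), of A B \<alpha> X Y, OF A B]
        by (simp add: r_def n_def p_def)
    qed
  qed
qed

end
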